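(* $\mathrm{ex}(n,\{F_1,F_2,F_3\})=\Theta(n^{3/2})$ as $n\to\infty$.
   Context: A triple system $H=(V,E)$ has a finite vertex set $V$, and $E$ is a set of $3$-element subsets of $V$ (no repeated triples). For a family $\mathcal{H}$ of triple systems, $\mathrm{ex}(n,\mathcal{H})$ is the maximum number of triples in a triple system on $n$ vertices that does not contain (an isomorphic copy of) any member of $\mathcal{H}$ as a (not necessarily induced) subsystem. A special four cycle has four distinct base vertices $v_1,v_2,v_3,v_4$ and four triples $\{w_i,v_i,v_{i+1}\}$, $i=1,2,3,4$ (indices modulo $4$), where the $w_j$ are not necessarily distinct but $w_i\neq v_j$ for all $1\le i,j\le 4$. The following are three of them: $F_1$: $w_1,w_2,w_3,w_4$ all different; $F_2$: $w_1=w_2=w_3=w_4$; $F_3$: $w_1=w_2$, $w_3=w_4$, $w_1\ne w_3$. *)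

theory Defs
  imports Complex_Main "HOL-Library.Landau_Symbols"
begin

type_synonym 'a tsys = "'a set \<times> 'a set set"

abbreviation verts :: "'a tsys \<Rightarrow> 'a set" where "verts \<equiv> fst"
abbreviation triples :: "'a tsys \<Rightarrow> 'a set set" where "triples \<equiv> snd"

definition triple_system :: "'a tsys \<Rightarrow> bool" where
  "triple_system H \<longleftrightarrow>
     finite (verts H) \<and> (\<forall>e \<in> triples H. e \<subseteq> verts H \<and> card e = 3)"

definition contains_copy :: "'a tsys \<Rightarrow> 'b tsys \<Rightarrow> bool" where
  "contains_copy H F \<longleftrightarrow>
     (\<exists>f. inj_on f (verts F) \<and> f ` verts F \<subseteq> verts H \<and> (\<forall>e \<in> triples F. f ` e \<in> triples H))"

definition family_free :: "'b tsys set \<Rightarrow> 'a tsys \<Rightarrow> bool" where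
  "family_free \<F> H \<longleftrightarrow> (\<forall>F \<in> \<F>. \<not> contains_copy H F)"

text \<open>
  Every finite triple system is isomorphic to one whose vertices are natural numbers, so it is no
  restriction to let the host systems range over those.
\<close>

definition ex_triples :: "nat \<Rightarrow> 'b tsys set \<Rightarrow> nat" where
  "ex_triples n \<F> =
     Max {card (triples H) | H :: nat tsys. triple_system H \<and> card (verts H) = n \<and> family_free \<F> H}"

text \<open>
  The maximum is taken over a finite set, which is nonempty as soon as every forbidden system has
  a triple.
\<close>

lemma finite_ex_triples_set:
  "finite {card (triples H) | H :: nat tsys. triple_system H \<and> card (verts H) = n \<and> family_free \<F> H}"
proof (rule finite_subset)
  show "{card (triples H) | H :: nat tsys. triple_system H \<and> card (verts H) = n \<and> family_free \<F> H}
          \<subseteq> {..2 ^ n}"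
  proof clarify
    fix V :: "nat set" and E :: "nat set set"
    assume ts: "triple_system (V, E)"
    hence fin: "finite V" and sub: "E \<subseteq> Pow V"
      by (auto simp: triple_system_def)
    have "card E \<le> card (Pow V)"
      using fin sub by (intro card_mono) auto
    thus "card (triples (V, E)) \<le> 2 ^ card (verts (V, E))"
      using fin by (simp add: card_Pow)
  qed
qed simp

lemma ex_triples_set_nonempty:
  assumes "\<And>F. F \<in> \<F> \<Longrightarrow> triples F \<noteq> {}"
  shows "{card (triples H) | H :: nat tsys. triple_system H \<and> card (verts H) = n \<and> family_free \<F> H} \<noteq> {}"
proof -
  have "triple_system ({..<n}, {})" "family_free \<F> ({..<n}, {})"
    using assms by (auto simp: triple_system_def family_free_def contains_copy_def)
  thus ?thesis by fastforce
qed

text \<open>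
  The vertices \<open>v\<^sub>i\<close> and \<open>w\<^sub>i\<close> are indexed by \<open>i \<in> {0,1,2,3}\<close> instead of \<open>{1,2,3,4}\<close>.
\<close>

definition special_four_cycle :: "(nat \<Rightarrow> 'a) \<Rightarrow> (nat \<Rightarrow> 'a) \<Rightarrow> bool" where
  "special_four_cycle v w \<longleftrightarrow> inj_on v {..<4} \<and> (\<forall>i<4. \<forall>j<4. w i \<noteq> v j)"

definition four_cycle_system :: "(nat \<Rightarrow> 'a) \<Rightarrow> (nat \<Rightarrow> 'a) \<Rightarrow> 'a tsys" where
  "four_cycle_system v w =
     (v ` {..<4} \<union> w ` {..<4}, (\<lambda>i. {w i, v i, v ((i + 1) mod 4)}) ` {..<4})"

definition F1 :: "nat tsys" where
  "F1 = four_cycle_system (\<lambda>i. i) (\<lambda>i. 4 + i)"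

definition F2 :: "nat tsys" where
  "F2 = four_cycle_system (\<lambda>i. i) (\<lambda>i. 4)"

definition F3 :: "nat tsys" where
  "F3 = four_cycle_system (\<lambda>i. i) (\<lambda>i. if i < 2 then 4 else 5)"

lemma special_four_cycle_F:
  "special_four_cycle (\<lambda>i. i) (\<lambda>i. 4 + i)"
  "special_four_cycle (\<lambda>i. i) (\<lambda>i. 4)"
  "special_four_cycle (\<lambda>i. i) (\<lambda>i. if i < 2 then 4 else 5)"
  by (auto simp: special_four_cycle_def)

lemma lessThan_4: "{..<4::nat} = {0, 1, 2, 3}"
  by auto

lemma F1_eq: "F1 = ({0,1,2,3,4,5,6,7}, {{4,0,1}, {5,1,2}, {6,2,3}, {7,3,0}})"
  by (auto simp: F1_def four_cycle_system_def lessThan_4)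

lemma F2_eq: "F2 = ({0,1,2,3,4}, {{4,0,1}, {4,1,2}, {4,2,3}, {4,3,0}})"
  by (auto simp: F2_def four_cycle_system_def lessThan_4)

lemma F3_eq: "F3 = ({0,1,2,3,4,5}, {{4,0,1}, {4,1,2}, {5,2,3}, {5,3,0}})"
  by (auto simp: F3_def four_cycle_system_def lessThan_4)

end

theory Submission
  imports Defs "HOL-Analysis.Convex" "HOL-Algebra.Algebraic_Closure_Type" "HOL-Library.Z2"
begin

text \<open>
  Upper bound. Call a pair of vertices heavy if it lies in at least eight triples, and light otherwise.
  Heavy pairs can be completed to triples with plenty of freedom, so a 4-cycle of heavy pairs extends to a
  copy of \<open>F1\<close>. Every triple can be written as \<open>{a, b, c}\<close> such that \<open>a c\<close> and \<open>b c\<close> are both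
  light or both heavy. A random 3-colouring of the vertices loses only a constant factor and makes \<open>a\<close>,
  \<open>b\<close> and \<open>c\<close> come from disjoint classes. In each of the two cases the triples are projected to pairs
  (to \<open>c a\<close> in the light case, to \<open>a b\<close> in the heavy case) with bounded fibres, and two distinct
  vertices can have only boundedly many common neighbours in the resulting bipartite graph: with too
  many, one finds \<open>F1\<close>, \<open>F2\<close>, \<open>F3\<close> or a heavy 4-cycle. The counting argument of Kovari, Sos
  and Turan then bounds the number of pairs by \<open>O(n powr (3/2))\<close>. The two cases are
  \<open>card_light_triples_le\<close> and \<open>card_heavy_triples_le\<close>, combined in \<open>card_triples_le\<close>.

  Lower bound. Take the bipartite incidence graph of points and non-vertical lines of the affine plane over
  the field with \<open>q = 2 ^ k\<close> elements, which contains no 4-cycle, replace each line by two copies, and turn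
  each incidence into the triple of the point and the two copies of the line. This system has
  \<open>3 q\<^sup>2\<close> vertices, \<open>q\<^sup>3\<close> triples, and no special four cycle at all
  (\<open>no_special_four_cycle_doubled\<close>). Consecutive values of \<open>3 q\<^sup>2\<close> differ by the factor
  \<open>4\<close>, so that this covers all \<open>n\<close> up to a constant (\<open>ex_triples_lower_bound\<close>).
\<close>

section \<open>Bipartite graphs with small codegrees\<close>

text \<open>
  The counting argument of Kovari, Sos and Turan. Both sides come from the number of triples
  \<open>(x, x', y)\<close> with \<open>y\<close> related to \<open>x\<close> and \<open>x'\<close>: it is at most \<open>t\<close> for each pair \<open>x \<noteq> x'\<close>, the
  diagonal contributes \<open>card R\<close>, and by Cauchy-Schwarz it is at least \<open>(card R)\<^sup>2 / card Q\<close>.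
\<close>

lemma card_squared_le_if_small_codegrees:
  fixes R :: "('a \<times> 'b) set"
  assumes P: "finite P" and Q: "finite Q" and R: "R \<subseteq> P \<times> Q"
    and cod: "\<And>x x'. x \<in> P \<Longrightarrow> x' \<in> P \<Longrightarrow> x \<noteq> x' \<Longrightarrow> card {y. (x, y) \<in> R \<and> (x', y) \<in> R} \<le> t"
  shows "(card R)\<^sup>2 \<le> card Q * (t * (card P)\<^sup>2 + card R)"
proof -
  define d where "d y = card {x \<in> P. (x, y) \<in> R}" for y
  have R_eq: "R = (SIGMA x:P. {y \<in> Q. (x, y) \<in> R})" "R = (\<lambda>(y, x). (x, y)) ` (SIGMA y:Q. {x \<in> P. (x, y) \<in> R})"
    using R by auto
  have card_R: "card R = (\<Sum>x\<in>P. card {y \<in> Q. (x, y) \<in> R})"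
    by (subst R_eq(1)) (use P Q in \<open>simp add: card_SigmaI\<close>)
  have card_R': "card R = (\<Sum>y\<in>Q. d y)"
    unfolding d_def by (subst R_eq(2), subst card_image) (use P Q in \<open>auto simp: card_SigmaI inj_on_def\<close>)
  have "(\<Sum>y\<in>Q. (d y)\<^sup>2) = (\<Sum>y\<in>Q. \<Sum>x\<in>P. \<Sum>x'\<in>P. if (x, y) \<in> R \<and> (x', y) \<in> R then 1 else 0)"
  proof (rule sum.cong[OF refl])
    fix y
    have "d y = (\<Sum>x\<in>P. if (x, y) \<in> R then 1 else 0)"
      unfolding d_def using P by (simp add: sum.If_cases Int_def)
    then show "(d y)\<^sup>2 = (\<Sum>x\<in>P. \<Sum>x'\<in>P. if (x, y) \<in> R \<and> (x', y) \<in> R then 1 else 0)"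
      by (simp add: power2_eq_square sum_product if_distrib[where f = "\<lambda>z. _ * z"] if_conn cong: if_cong)
        (intro sum.cong; simp)
  qed
  also have "\<dots> = (\<Sum>x\<in>P. \<Sum>x'\<in>P. \<Sum>y\<in>Q. if (x, y) \<in> R \<and> (x', y) \<in> R then 1 else 0)"
    by (subst sum.swap, rule sum.cong[OF refl], rule sum.swap)
  also have "\<dots> = (\<Sum>x\<in>P. \<Sum>x'\<in>P. card {y \<in> Q. (x, y) \<in> R \<and> (x', y) \<in> R})"
    using Q by (simp add: sum.If_cases Int_def)
  also have "\<dots> \<le> (\<Sum>x\<in>P. \<Sum>x'\<in>P. t + (if x' = x then card {y \<in> Q. (x, y) \<in> R} else 0))"
  proof (intro sum_mono)
    fix x x' assume "x \<in> P" "x' \<in> P"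
    moreover have "{y \<in> Q. (x, y) \<in> R \<and> (x', y) \<in> R} = {y. (x, y) \<in> R \<and> (x', y) \<in> R}"
      using R by auto
    ultimately show "card {y \<in> Q. (x, y) \<in> R \<and> (x', y) \<in> R} \<le> t + (if x' = x then card {y \<in> Q. (x, y) \<in> R} else 0)"
      using cod[of x x'] by auto
  qed
  also have "\<dots> = t * (card P)\<^sup>2 + card R"
    using P by (simp add: sum.distrib card_R power2_eq_square)
  finally have "(\<Sum>y\<in>Q. (d y)\<^sup>2) \<le> t * (card P)\<^sup>2 + card R" .
  moreover have "(card R)\<^sup>2 \<le> card Q * (\<Sum>y\<in>Q. (d y)\<^sup>2)"
  proof -
    have "(\<Sum>y\<in>Q. real (d y))\<^sup>2 \<le> (\<Sum>y\<in>Q. (real (d y))\<^sup>2) * card Q"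
      by (rule sum_squared_le_sum_of_squares)
    then have "real ((card R)\<^sup>2) \<le> real (card Q * (\<Sum>y\<in>Q. (d y)\<^sup>2))"
      unfolding card_R' by (simp add: mult.commute)
    then show ?thesis by (simp only: of_nat_le_iff)
  qed
  ultimately show ?thesis
    by (meson le_trans mult_le_mono2)
qed

text \<open>
  This is the only place where the exponent \<open>3/2\<close> enters the upper bound. The term \<open>n * card R\<close> in
  \<open>(card R)\<^sup>2 \<le> t n\<^sup>3 + n * card R\<close> can be absorbed unless \<open>card R \<le> 2 n\<close>, where nothing is left to
  show.
\<close>

lemma card_le_if_small_codegrees:
  fixes R :: "('a \<times> 'b) set"
  assumes P: "finite P" "card P \<le> n" and Q: "finite Q" "card Q \<le> n" and R: "R \<subseteq> P \<times> Q"
    and cod: "\<And>x x'. x \<in> P \<Longrightarrow> x' \<in> P \<Longrightarrow> x \<noteq> x' \<Longrightarrow> card {y. (x, y) \<in> R \<and> (x', y) \<in> R} \<le> t"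
  shows "real (card R) \<le> (real t + 2) * (real n * sqrt (real n))"
proof -
  let ?e = "real (card R)" and ?n = "real n"
  have "(card R)\<^sup>2 \<le> card Q * (t * (card P)\<^sup>2 + card R)"
    using card_squared_le_if_small_codegrees[OF P(1) Q(1) R cod] .
  also have "\<dots> \<le> n * (t * n\<^sup>2 + card R)"
    using P Q by (intro mult_le_mono add_mono power_mono) auto
  finally have "real ((card R)\<^sup>2) \<le> real (n * (t * n\<^sup>2 + card R))"
    by (simp only: of_nat_le_iff)
  then have main: "?e\<^sup>2 \<le> t * ?n ^ 3 + ?n * ?e"
    by (simp add: algebra_simps power2_eq_square power3_eq_cube)
  have n3: "?n\<^sup>2 \<le> ?n ^ 3"
    by (cases n) (auto simp: power3_eq_cube power2_eq_square)
  have "?e\<^sup>2 \<le> (2 * real t + 4) * ?n ^ 3"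
  proof (cases "?e \<le> 2 * ?n")
    case True
    then have "?e\<^sup>2 \<le> (2 * ?n)\<^sup>2" by (intro power_mono) auto
    also have "\<dots> \<le> 4 * ?n ^ 3" using n3 by simp
    also have "\<dots> \<le> (2 * real t + 4) * ?n ^ 3" by (intro mult_right_mono) auto
    finally show ?thesis .
  next
    case False
    then have "2 * ?n * ?e \<le> ?e * ?e" by (intro mult_right_mono) auto
    with main have "?e\<^sup>2 \<le> 2 * (t * ?n ^ 3)" by (simp add: power2_eq_square)
    also have "\<dots> \<le> (2 * real t + 4) * ?n ^ 3" by (simp add: algebra_simps)
    finally show ?thesis .
  qed
  also have "\<dots> \<le> (real t + 2)\<^sup>2 * ?n ^ 3"
    by (intro mult_right_mono) (auto simp: power2_eq_square algebra_simps)
  also have "\<dots> = ((real t + 2) * (?n * sqrt ?n))\<^sup>2"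
    by (simp add: power_mult_distrib power3_eq_cube power2_eq_square)
  finally show ?thesis
    by (rule power2_le_imp_le) auto
qed

section \<open>Selecting a tripartite subsystem and a rainbow cycle\<close>

text \<open>
  A uniformly random colouring \<open>V \<rightarrow> {0, 1, 2}\<close> gives a fixed triple of distinct vertices the colours
  \<open>0, 1, 2\<close> in this order with probability \<open>1/27\<close>; some colouring does at least as well as the average.
\<close>

lemma exists_tripartite_colouring:
  fixes T :: "('a \<times> 'a \<times> 'a) set"
  assumes V: "finite V" and T: "T \<subseteq> V \<times> V \<times> V"
    and dist: "\<And>a b c. (a, b, c) \<in> T \<Longrightarrow> distinct [a, b, c]"
  obtains f :: "'a \<Rightarrow> nat"
  where "card T \<le> 27 * card {(a, b, c) \<in> T. f a = 0 \<and> f b = 1 \<and> f c = 2}"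
proof (cases "T = {}")
  case True
  then show ?thesis by (intro that[of "\<lambda>_. 0"]) simp
next
  case False
  define \<Phi> where "\<Phi> = V \<rightarrow>\<^sub>E {..<3::nat}"
  define good where "good f t = (case t of (a, b, c) \<Rightarrow> f a = 0 \<and> f b = 1 \<and> f c = (2::nat))"
    for f :: "'a \<Rightarrow> nat" and t :: "'a \<times> 'a \<times> 'a"
  have finT: "finite T" using V T by (meson finite_SigmaI finite_subset)
  have fin\<Phi>: "finite \<Phi>" unfolding \<Phi>_def using V by (intro finite_PiE) auto
  have card\<Phi>: "card \<Phi> = 3 ^ card V" unfolding \<Phi>_def using V by (simp add: card_PiE)
  have good_count: "27 * card {f \<in> \<Phi>. good f t} = card \<Phi>" if t: "t \<in> T" for t
  proof -
    obtain a b c where abc: "t = (a, b, c)" by (cases t)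
    with t T dist have d: "a \<noteq> b" "a \<noteq> c" "b \<noteq> c" and mem: "a \<in> V" "b \<in> V" "c \<in> V" by force+
    define S where "S v = (if v = a then {0} else if v = b then {1} else if v = c then {2} else {..<3::nat})" for v
    have "{f \<in> \<Phi>. good f t} = Pi\<^sub>E V S"
      using d mem
      by (auto simp: \<Phi>_def good_def abc S_def PiE_iff extensional_def split: if_splits)
    moreover have "card (Pi\<^sub>E V S) = (\<Prod>v\<in>V. card (S v))"
      using V by (simp add: card_PiE)
    moreover have "(\<Prod>v\<in>V. card (S v)) = (\<Prod>v\<in>V - {a, b, c}. card (S v)) * (\<Prod>v\<in>{a, b, c}. card (S v))"
      using V mem by (intro prod.subset_diff) auto
    moreover have "(\<Prod>v\<in>V - {a, b, c}. card (S v)) = (\<Prod>v\<in>V - {a, b, c}. 3)"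
      by (intro prod.cong) (auto simp: S_def)
    moreover have "(\<Prod>v\<in>{a, b, c}. card (S v)) = 1"
      using d by (simp add: S_def)
    moreover have "card (V - {a, b, c}) = card V - 3" "3 \<le> card V"
      using d mem V card_mono[of V "{a, b, c}"] by (auto simp: card_Diff_subset)
    ultimately show ?thesis
      using power_add[of "3::nat" 3 "card V - 3"] by (simp add: card\<Phi>)
  qed
  have "(\<Sum>f\<in>\<Phi>. card T) = (\<Sum>t\<in>T. 27 * card {f \<in> \<Phi>. good f t})"
    using good_count by simp
  also have "\<dots> = 27 * (\<Sum>t\<in>T. \<Sum>f\<in>\<Phi>. if good f t then 1 else 0)"
    using fin\<Phi> by (simp add: sum_distrib_left[symmetric] sum.If_cases Int_def)
  also have "\<dots> = 27 * (\<Sum>f\<in>\<Phi>. \<Sum>t\<in>T. if good f t then 1 else 0)"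
    by (subst sum.swap) simp
  also have "\<dots> = (\<Sum>f\<in>\<Phi>. 27 * card {t \<in> T. good f t})"
    using finT by (simp add: sum_distrib_left[symmetric] sum.If_cases Int_def)
  finally have eq: "(\<Sum>f\<in>\<Phi>. card T) = (\<Sum>f\<in>\<Phi>. 27 * card {t \<in> T. good f t})" .
  have "\<Phi> \<noteq> {}" using card\<Phi> by auto
  have "\<exists>f\<in>\<Phi>. card T \<le> 27 * card {t \<in> T. good f t}"
  proof (rule ccontr)
    assume "\<not> ?thesis"
    then have "(\<Sum>f\<in>\<Phi>. 27 * card {t \<in> T. good f t}) < (\<Sum>f\<in>\<Phi>. card T)"
      using fin\<Phi> \<open>\<Phi> \<noteq> {}\<close> by (intro sum_strict_mono) (auto simp: not_le)
    with eq show False by simp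
  qed
  then obtain f where f: "card T \<le> 27 * card {t \<in> T. good f t}" by blast
  moreover have "{t \<in> T. good f t} = {(a, b, c) \<in> T. f a = 0 \<and> f b = 1 \<and> f c = 2}"
    by (auto simp: good_def)
  ultimately show ?thesis using that[of f] by simp
qed

text \<open>
  For a fixed \<open>i\<close>, each of the four coincidences between \<open>{f i, g i}\<close> and \<open>{f j, g j}\<close> rules out at most
  \<open>k\<close> indices \<open>j\<close>. The lemma is applied to the common neighbours \<open>i\<close> of two vertices \<open>u\<close> and \<open>u'\<close>,
  with \<open>f i\<close> and \<open>g i\<close> the third vertices of triples on \<open>u i\<close> and \<open>u' i\<close>: the cycle \<open>u i u' j\<close>
  is then a copy of \<open>F1\<close>.
\<close>

lemma exists_pair_of_disjoint_colours:
  assumes I: "finite I" "4 * k < card I"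
    and ne: "\<And>i. i \<in> I \<Longrightarrow> f i \<noteq> g i"
    and f: "\<And>z. card {i \<in> I. f i = z} \<le> k" and g: "\<And>z. card {i \<in> I. g i = z} \<le> k"
  obtains i j where "i \<in> I" "j \<in> I" "distinct [f i, g i, f j, g j]"
proof -
  from I obtain i where i: "i \<in> I" by fastforce
  let ?A = "{j \<in> I. f j = f i}" and ?B = "{j \<in> I. f j = g i}"
    and ?C = "{j \<in> I. g j = f i}" and ?D = "{j \<in> I. g j = g i}"
  have "card (?A \<union> ?B \<union> (?C \<union> ?D)) \<le> (card ?A + card ?B) + (card ?C + card ?D)"
    by (meson add_mono card_Un_le le_trans)
  also have "\<dots> \<le> 4 * k" using f[of "f i"] f[of "g i"] g[of "f i"] g[of "g i"] by linarith
  finally have "card (?A \<union> ?B \<union> (?C \<union> ?D)) < card I" using I by linarith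
  then have "\<not> I \<subseteq> ?A \<union> ?B \<union> (?C \<union> ?D)"
    using I by (metis (no_types, lifting) card_mono finite_Un finite_subset leD mem_Collect_eq subsetI)
  then obtain j where "j \<in> I" "j \<notin> ?A \<union> ?B \<union> (?C \<union> ?D)" by blast
  with i ne[of i] ne[of j] show ?thesis by (intro that[of i j]) auto
qed

section \<open>The upper bound\<close>

definition link :: "'a set set \<Rightarrow> 'a \<Rightarrow> 'a \<Rightarrow> 'a set" where
  "link E u v = {w. {u, v, w} \<in> E}"

text \<open>
  The threshold makes it possible to choose the third vertex of a triple on a heavy pair while avoiding
  seven given vertices, which is what the embedding of \<open>F1\<close> with its eight vertices may require.
\<close>

definition heavy :: "'a set set \<Rightarrow> 'a \<Rightarrow> 'a \<Rightarrow> bool" where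
  "heavy E u v \<longleftrightarrow> 8 \<le> card (link E u v)"

lemma heavy_commute: "heavy E u v \<longleftrightarrow> heavy E v u"
  by (simp add: heavy_def link_def insert_commute)

text \<open>
  The absence of \<open>F1\<close>, \<open>F2\<close> and \<open>F3\<close>, spelled out for vertices instead of embeddings. The four base
  vertices \<open>v0, v1, v2, v3\<close> are in cyclic order.
\<close>

locale F_free_triples =
  fixes E :: "'a set set"
  assumes finite_triples: "finite E"
    and card_triple: "e \<in> E \<Longrightarrow> card e = 3"
    and no_F1: "distinct [v0, v1, v2, v3, w0, w1, w2, w3] \<Longrightarrow> {w0, v0, v1} \<in> E \<Longrightarrow> {w1, v1, v2} \<in> E \<Longrightarrow>
      {w2, v2, v3} \<in> E \<Longrightarrow> {w3, v3, v0} \<in> E \<Longrightarrow> False"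
    and no_F2: "distinct [v0, v1, v2, v3, w] \<Longrightarrow> {w, v0, v1} \<in> E \<Longrightarrow> {w, v1, v2} \<in> E \<Longrightarrow>
      {w, v2, v3} \<in> E \<Longrightarrow> {w, v3, v0} \<in> E \<Longrightarrow> False"
    and no_F3: "distinct [v0, v1, v2, v3, w, w'] \<Longrightarrow> {w, v0, v1} \<in> E \<Longrightarrow> {w, v1, v2} \<in> E \<Longrightarrow>
      {w', v2, v3} \<in> E \<Longrightarrow> {w', v3, v0} \<in> E \<Longrightarrow> False"
begin

lemma triple_distinct: "{u, v, w} \<in> E \<Longrightarrow> distinct [u, v, w]"
  using card_triple[of "{u, v, w}"] by (auto simp: card_insert_if split: if_splits)

lemma finite_vertices: "finite (\<Union>E)"
  by (intro finite_Union finite_triples) (use card_triple in \<open>force intro: card_ge_0_finite\<close>)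

lemma finite_link: "finite (link E u v)"
  by (rule finite_subset[OF _ finite_vertices]) (auto simp: link_def)

lemma heavy_fresh:
  assumes "heavy E u v" and "length xs \<le> 7"
  obtains w where "{w, u, v} \<in> E" "w \<notin> set xs" "w \<noteq> u" "w \<noteq> v"
proof -
  have "card (set xs) < card (link E u v)"
    using assms card_length[of xs] by (auto simp: heavy_def)
  then have "\<not> link E u v \<subseteq> set xs"
    using card_mono[of "set xs" "link E u v"] by auto
  then obtain w where w: "{u, v, w} \<in> E" "w \<notin> set xs" by (auto simp: link_def)
  with triple_distinct[of u v w] show ?thesis
    by (intro that[of w]) (auto simp: insert_commute)
qed

text \<open>
  The four pairs of a heavy 4-cycle can be completed greedily by distinct new vertices, giving \<open>F1\<close>.
\<close>

lemma no_heavy_four_cycle: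
  assumes d: "distinct [v0, v1, v2, v3]"
    and h: "heavy E v0 v1" "heavy E v1 v2" "heavy E v2 v3" "heavy E v3 v0"
  shows False
proof -
  obtain w0 where w0: "{w0, v0, v1} \<in> E" "w0 \<notin> set [v2, v3]" "w0 \<noteq> v0" "w0 \<noteq> v1"
    using heavy_fresh[OF h(1), of "[v2, v3]"] by auto
  obtain w1 where w1: "{w1, v1, v2} \<in> E" "w1 \<notin> set [v0, v3, w0]" "w1 \<noteq> v1" "w1 \<noteq> v2"
    using heavy_fresh[OF h(2), of "[v0, v3, w0]"] by auto
  obtain w2 where w2: "{w2, v2, v3} \<in> E" "w2 \<notin> set [v0, v1, w0, w1]" "w2 \<noteq> v2" "w2 \<noteq> v3"
    using heavy_fresh[OF h(3), of "[v0, v1, w0, w1]"] by auto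
  obtain w3 where w3: "{w3, v3, v0} \<in> E" "w3 \<notin> set [v1, v2, w0, w1, w2]" "w3 \<noteq> v3" "w3 \<noteq> v0"
    using heavy_fresh[OF h(4), of "[v1, v2, w0, w1, w2]"] by auto
  show False
    using no_F1[OF _ w0(1) w1(1) w2(1) w3(1)] d w0 w1 w2 w3 by auto
qed

text \<open>
  Two adjacent heavy pairs suffice for the greedy completion when the other two pairs of the cycle already
  have distinct third vertices off the cycle.
\<close>

lemma no_half_heavy_four_cycle:
  assumes d: "distinct [c, b, a, b', x, y]" and h: "heavy E c b" "heavy E b' c"
    and "{x, b, a} \<in> E" "{y, a, b'} \<in> E"
  shows False
proof -
  obtain w where w: "{w, c, b} \<in> E" "w \<notin> set [a, b', x, y]" "w \<noteq> c" "w \<noteq> b"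
    using heavy_fresh[OF h(1), of "[a, b', x, y]"] by auto
  obtain z where z: "{z, b', c} \<in> E" "z \<notin> set [b, a, x, y, w]" "z \<noteq> b'" "z \<noteq> c"
    using heavy_fresh[OF h(2), of "[b, a, x, y, w]"] by auto
  show False
    using no_F1[OF _ w(1) assms(4,5) z(1)] d w z by auto
qed

lemma light_fibre_le: "\<not> heavy E u v \<Longrightarrow> (\<And>i. i \<in> I \<Longrightarrow> {u, v, i} \<in> E) \<Longrightarrow> card I \<le> 7"
  using card_mono[OF finite_link[of u v], of I] by (fastforce simp: link_def heavy_def)

text \<open>
  The relation to which the counting lemma is applied consists of the pairs \<open>(c, a)\<close>; lightness of
  \<open>a c\<close> means that at most seven triples lie over each of them. Suppose that \<open>c \<noteq> c'\<close> have a large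
  set \<open>I\<close> of common neighbours \<open>a\<close>, and choose triples with third vertices \<open>\<beta> a\<close> over \<open>a c\<close> and
  \<open>\<beta>' a\<close> over \<open>a c'\<close>. Since \<open>b c\<close> is light, each value of \<open>\<beta>\<close> and \<open>\<beta>'\<close> is taken at most
  seven times. Two common neighbours where \<open>\<beta>\<close> and \<open>\<beta>'\<close> agree, with different values, would form
  \<open>F3\<close>, so at most seven of them have \<open>\<beta> a = \<beta>' a\<close>; among more than \<open>4 * 7\<close> others there would be
  an \<open>F1\<close>. Hence there are at most \<open>35\<close> common neighbours. The colouring \<open>f\<close> keeps base vertices and
  third vertices apart.
\<close>

lemma card_light_triples_le:
  assumes V: "finite V" "card V \<le> n" and T: "T \<subseteq> V \<times> V \<times> V"
    and E: "\<And>a b c. (a, b, c) \<in> T \<Longrightarrow> {a, b, c} \<in> E"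
    and col: "\<And>a b c. (a, b, c) \<in> T \<Longrightarrow> f a = (0::nat) \<and> f b = 1 \<and> f c = 2"
    and light: "\<And>a b c. (a, b, c) \<in> T \<Longrightarrow> \<not> heavy E a c \<and> \<not> heavy E b c"
  shows "real (card T) \<le> 259 * (real n * sqrt (real n))"
proof -
  define R where "R = (\<lambda>(a, b, c). (c, a)) ` T"
  have finT: "finite T" using V T by (meson finite_SigmaI finite_subset)
  have finR: "finite R" using finT by (simp add: R_def)
  have "T \<subseteq> (\<Union>(c, a)\<in>R. (\<lambda>b. (a, b, c)) ` {b. (a, b, c) \<in> T})"
    by (force simp: R_def)
  then have "card T \<le> card (\<Union>(c, a)\<in>R. (\<lambda>b. (a, b, c)) ` {b. (a, b, c) \<in> T})"
    using finT by (intro card_mono) (auto intro!: finite_subset[OF _ finT] finR)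
  also have "\<dots> \<le> (\<Sum>(c, a)\<in>R. card ((\<lambda>b. (a, b, c)) ` {b. (a, b, c) \<in> T}))"
    using card_UN_le[OF finR, of "\<lambda>(c, a). (\<lambda>b. (a, b, c)) ` {b. (a, b, c) \<in> T}"]
    by (simp add: case_prod_unfold)
  also have "\<dots> \<le> (\<Sum>p\<in>R. 7)"
  proof (rule sum_mono, clarify)
    fix c a assume "(c, a) \<in> R"
    then have "\<not> heavy E a c" using light by (auto simp: R_def)
    then have "card {b. (a, b, c) \<in> T} \<le> 7"
    proof (rule light_fibre_le)
      fix b assume "b \<in> {b. (a, b, c) \<in> T}"
      then have "{a, b, c} \<in> E" using E by blast
      then show "{a, c, b} \<in> E" by (simp add: insert_commute)
    qed
    then show "card ((\<lambda>b. (a, b, c)) ` {b. (a, b, c) \<in> T}) \<le> 7"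
      by (subst card_image) (auto simp: inj_on_def)
  qed
  finally have "card T \<le> 7 * card R" by simp
  moreover have "real (card R) \<le> (real 35 + 2) * (real n * sqrt (real n))"
  proof (rule card_le_if_small_codegrees[OF V V])
    show "R \<subseteq> V \<times> V" using T by (auto simp: R_def)
    fix c c' :: 'a assume "c \<noteq> c'"
    define I where "I = {a. (c, a) \<in> R \<and> (c', a) \<in> R}"
    have finI: "finite I"
      by (rule finite_subset[of _ "snd ` R"]) (use finR in \<open>force simp: I_def\<close>)+
    obtain \<beta> where \<beta>: "(c, a) \<in> R \<Longrightarrow> (a, \<beta> a, c) \<in> T" for a
      by (rule that[of "\<lambda>a. SOME b. (a, b, c) \<in> T"]) (auto simp: R_def intro: someI)
    obtain \<beta>' where \<beta>': "(c', a) \<in> R \<Longrightarrow> (a, \<beta>' a, c') \<in> T" for a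
      by (rule that[of "\<lambda>a. SOME b. (a, b, c') \<in> T"]) (auto simp: R_def intro: someI)
    have T\<beta>: "(a, \<beta> a, c) \<in> T" "(a, \<beta>' a, c') \<in> T" if "a \<in> I" for a
      using that \<beta> \<beta>' by (auto simp: I_def)
    note colI = col[OF T\<beta>(1)] col[OF T\<beta>(2)] and EI = E[OF T\<beta>(1)] E[OF T\<beta>(2)]
    have fibre: "card {a \<in> J. \<beta> a = z} \<le> 7" "card {a \<in> J. \<beta>' a = z} \<le> 7" if "J \<subseteq> I" for z J
    proof -
      show "card {a \<in> J. \<beta> a = z} \<le> 7"
      proof (cases "{a \<in> J. \<beta> a = z} = {}")
        case False
        then have "\<not> heavy E z c" using light[OF T\<beta>(1)] that by blast
        then show ?thesis by (rule light_fibre_le) (use EI(1) that in \<open>auto simp: insert_commute\<close>)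
      qed (simp only: card.empty)
      show "card {a \<in> J. \<beta>' a = z} \<le> 7"
      proof (cases "{a \<in> J. \<beta>' a = z} = {}")
        case False
        then have "\<not> heavy E z c'" using light[OF T\<beta>(2)] that by blast
        then show ?thesis by (rule light_fibre_le) (use EI(2) that in \<open>auto simp: insert_commute\<close>)
      qed (simp only: card.empty)
    qed
    define D where "D = {a \<in> I. \<beta> a = \<beta>' a}"
    have "card D \<le> 7"
    proof (cases "D = {}")
      case False
      then obtain a where a: "a \<in> D" by blast
      have "\<beta> x = \<beta> a" if x: "x \<in> D" for x
      proof (rule ccontr)
        assume ne: "\<beta> x \<noteq> \<beta> a"
        have I: "a \<in> I" "x \<in> I" "\<beta>' a = \<beta> a" "\<beta>' x = \<beta> x" using a x by (auto simp: D_def)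
        show False
        proof (rule no_F3[of c a c' x "\<beta> a" "\<beta> x"])
          show "distinct [c, a, c', x, \<beta> a, \<beta> x]"
            using ne I \<open>c \<noteq> c'\<close> colI[of a] colI[of x] by auto
        qed (use EI[of a] EI[of x] I in \<open>auto simp: insert_commute\<close>)
      qed
      then have "D \<subseteq> {x \<in> I. \<beta> x = \<beta> a}" by (auto simp: D_def)
      then have "card D \<le> card {x \<in> I. \<beta> x = \<beta> a}" using finI by (intro card_mono) auto
      with fibre(1)[of I "\<beta> a"] show ?thesis by simp
    qed simp
    moreover have "card (I - D) \<le> 4 * 7"
    proof (rule ccontr)
      assume big: "\<not> ?thesis"
      obtain i j where ij: "i \<in> I - D" "j \<in> I - D" "distinct [\<beta> i, \<beta>' i, \<beta> j, \<beta>' j]"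
      proof (rule exists_pair_of_disjoint_colours)
        show "finite (I - D)" "4 * 7 < card (I - D)" using finI big by simp_all
        show "\<beta> i \<noteq> \<beta>' i" if "i \<in> I - D" for i using that by (auto simp: D_def)
        show "card {i \<in> I - D. \<beta> i = z} \<le> 7" "card {i \<in> I - D. \<beta>' i = z} \<le> 7" for z
          by (rule fibre; blast)+
      qed (rule that)
      show False
      proof (rule no_F1[of c i c' j "\<beta> i" "\<beta>' i" "\<beta>' j" "\<beta> j"])
        show "distinct [c, i, c', j, \<beta> i, \<beta>' i, \<beta>' j, \<beta> j]"
          using ij \<open>c \<noteq> c'\<close> colI[of i] colI[of j] by auto
      qed (use EI[of i] EI[of j] ij in \<open>auto simp: insert_commute\<close>)
    qed
    moreover have "card I = card D + card (I - D)"
    proof -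
      have "D \<subseteq> I" by (auto simp: D_def)
      with finI show ?thesis
        using card_mono[of I D] card_Diff_subset[of D I] finite_subset[of D I] by simp
    qed
    ultimately show "card {a. (c, a) \<in> R \<and> (c', a) \<in> R} \<le> 35"
      unfolding I_def[symmetric] by linarith
  qed
  ultimately show ?thesis by simp
qed

text \<open>
  Here the counting lemma is applied to the pairs \<open>(a, b)\<close>. Such a pair determines \<open>c\<close>, because two
  choices would form a heavy 4-cycle. Let \<open>\<gamma> b\<close> and \<open>\<gamma>' b\<close> be the third vertices for a common
  neighbour \<open>b\<close> of \<open>a\<close> and \<open>a'\<close>. At most one \<open>b\<close> has \<open>\<gamma> b = \<gamma>' b\<close>: two of them form \<open>F2\<close> if
  the values are equal, and a heavy 4-cycle otherwise. On the remaining common neighbours \<open>\<gamma>\<close> and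
  \<open>\<gamma>'\<close> are injective: if \<open>\<gamma> x = \<gamma> y\<close>, then \<open>x\<close> and \<open>y\<close> have a common heavy neighbour, and
  either \<open>\<gamma>' x = \<gamma>' y\<close> is a second one or the half-heavy cycle \<open>\<gamma> x, x, a', y\<close> arises. So five
  of them would give \<open>F1\<close>.
\<close>

lemma card_heavy_triples_le:
  assumes V: "finite V" "card V \<le> n" and T: "T \<subseteq> V \<times> V \<times> V"
    and E: "\<And>a b c. (a, b, c) \<in> T \<Longrightarrow> {a, b, c} \<in> E"
    and col: "\<And>a b c. (a, b, c) \<in> T \<Longrightarrow> f a = (0::nat) \<and> f b = 1 \<and> f c = 2"
    and heavy: "\<And>a b c. (a, b, c) \<in> T \<Longrightarrow> heavy E a c \<and> heavy E b c"
  shows "real (card T) \<le> 7 * (real n * sqrt (real n))"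
proof -
  define R where "R = (\<lambda>(a, b, c). (a, b)) ` T"
  have finT: "finite T" using V T by (meson finite_SigmaI finite_subset)
  have finR: "finite R" using finT by (simp add: R_def)
  have inj: "c = c'" if "(a, b, c) \<in> T" "(a, b, c') \<in> T" for a b c c'
    using no_heavy_four_cycle[of a c b c'] that[THEN heavy] that[THEN col] heavy_commute by fastforce
  have "card R = card T"
    unfolding R_def by (rule card_image) (auto simp: inj_on_def intro: inj)
  moreover have "real (card R) \<le> (real 5 + 2) * (real n * sqrt (real n))"
  proof (rule card_le_if_small_codegrees[OF V V])
    show "R \<subseteq> V \<times> V" using T by (auto simp: R_def)
    fix a a' :: 'a assume "a \<noteq> a'"
    define I where "I = {b. (a, b) \<in> R \<and> (a', b) \<in> R}"
    have finI: "finite I"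
      by (rule finite_subset[of _ "snd ` R"]) (use finR in \<open>force simp: I_def\<close>)+
    obtain \<gamma> where \<gamma>: "(a, b) \<in> R \<Longrightarrow> (a, b, \<gamma> b) \<in> T" for b
      by (rule that[of "\<lambda>b. SOME c. (a, b, c) \<in> T"]) (auto simp: R_def intro: someI)
    obtain \<gamma>' where \<gamma>': "(a', b) \<in> R \<Longrightarrow> (a', b, \<gamma>' b) \<in> T" for b
      by (rule that[of "\<lambda>b. SOME c. (a', b, c) \<in> T"]) (auto simp: R_def intro: someI)
    have T\<gamma>: "(a, b, \<gamma> b) \<in> T" "(a', b, \<gamma>' b) \<in> T" if "b \<in> I" for b
      using that \<gamma> \<gamma>' by (auto simp: I_def)
    note colI = col[OF T\<gamma>(1)] col[OF T\<gamma>(2)] and EI = E[OF T\<gamma>(1)] E[OF T\<gamma>(2)]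
      and heavyI = heavy[OF T\<gamma>(1)] heavy[OF T\<gamma>(2)]
    define D where "D = {b \<in> I. \<gamma> b = \<gamma>' b}"
    have "card D \<le> 1"
    proof -
      have False if x: "x \<in> D" "y \<in> D" "x \<noteq> y" for x y
      proof -
        have I: "x \<in> I" "y \<in> I" "\<gamma>' x = \<gamma> x" "\<gamma>' y = \<gamma> y" using x by (auto simp: D_def)
        show False
        proof (cases "\<gamma> x = \<gamma> y")
          case True
          show False
          proof (rule no_F2[of a x a' y "\<gamma> x"])
            show "distinct [a, x, a', y, \<gamma> x]"
              using x \<open>a \<noteq> a'\<close> colI[of x] colI[of y] by (auto simp: D_def)
          qed (use EI[of x] EI[of y] x True in \<open>auto simp: D_def insert_commute\<close>)
        next
          case False
          show False
          proof (rule no_heavy_four_cycle[of a "\<gamma> x" a' "\<gamma> y"])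
            show "distinct [a, \<gamma> x, a', \<gamma> y]"
              using x False \<open>a \<noteq> a'\<close> colI[of x] colI[of y] by (auto simp: D_def)
          qed (use heavyI[of x] heavyI[of y] I heavy_commute in metis)+
        qed
      qed
      then show ?thesis using finI by (auto simp: D_def card_le_Suc0_iff_eq)
    qed
    moreover have "card (I - D) \<le> 4 * 1"
    proof (rule ccontr)
      assume big: "\<not> ?thesis"
      have eq: "x = y" if xy: "x \<in> I - D" "y \<in> I - D" "\<gamma> x = \<gamma> y \<or> \<gamma>' x = \<gamma>' y" for x y
      proof (rule ccontr)
        assume "x \<noteq> y"
        have I: "x \<in> I" "y \<in> I" "\<gamma> x \<noteq> \<gamma>' x" "\<gamma> y \<noteq> \<gamma>' y" using that by (auto simp: D_def)
        note c = colI(1)[OF I(1)] colI(2)[OF I(1)] colI(1)[OF I(2)] colI(2)[OF I(2)]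
        note h = heavyI(1)[OF I(1)] heavyI(2)[OF I(1)] heavyI(1)[OF I(2)] heavyI(2)[OF I(2)]
        have e: "{\<gamma> x, x, a} \<in> E" "{\<gamma>' x, x, a'} \<in> E" "{\<gamma> y, a, y} \<in> E" "{\<gamma>' y, a', y} \<in> E"
          using EI(1)[OF I(1)] EI(2)[OF I(1)] EI(1)[OF I(2)] EI(2)[OF I(2)]
          by (simp_all add: insert_commute)
        consider "\<gamma> x = \<gamma> y" "\<gamma>' x = \<gamma>' y" | "\<gamma> x = \<gamma> y" "\<gamma>' x \<noteq> \<gamma>' y" | "\<gamma> x \<noteq> \<gamma> y" "\<gamma>' x = \<gamma>' y"
          using xy(3) by blast
        then show False
        proof cases
          case 1
          show False
          proof (rule no_heavy_four_cycle[of x "\<gamma> x" y "\<gamma>' x"])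
            show "distinct [x, \<gamma> x, y, \<gamma>' x]" using c I \<open>x \<noteq> y\<close> by auto
          qed (use h 1 heavy_commute in metis)+
        next
          case 2
          show False
          proof (rule no_half_heavy_four_cycle[of "\<gamma> x" x a' y "\<gamma>' x" "\<gamma>' y"])
            show "distinct [\<gamma> x, x, a', y, \<gamma>' x, \<gamma>' y]" using c I \<open>x \<noteq> y\<close> 2 by auto
          qed (use e h 2 heavy_commute in metis)+
        next
          case 3
          show False
          proof (rule no_half_heavy_four_cycle[of "\<gamma>' x" x a y "\<gamma> x" "\<gamma> y"])
            show "distinct [\<gamma>' x, x, a, y, \<gamma> x, \<gamma> y]" using c I \<open>x \<noteq> y\<close> 3 by auto
          qed (use e h 3 heavy_commute in metis)+
        qed
      qed
      then have fibre: "card {b \<in> I - D. \<gamma> b = z} \<le> 1" "card {b \<in> I - D. \<gamma>' b = z} \<le> 1" for z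
        using finI by (auto simp: card_le_Suc0_iff_eq)
      obtain i j where ij: "i \<in> I - D" "j \<in> I - D" "distinct [\<gamma> i, \<gamma>' i, \<gamma> j, \<gamma>' j]"
      proof (rule exists_pair_of_disjoint_colours)
        show "finite (I - D)" "4 * 1 < card (I - D)" using finI big by simp_all
        show "\<gamma> i \<noteq> \<gamma>' i" if "i \<in> I - D" for i using that by (auto simp: D_def)
      qed (rule fibre that)+
      show False
      proof (rule no_F1[of a i a' j "\<gamma> i" "\<gamma>' i" "\<gamma>' j" "\<gamma> j"])
        show "distinct [a, i, a', j, \<gamma> i, \<gamma>' i, \<gamma>' j, \<gamma> j]"
          using ij \<open>a \<noteq> a'\<close> colI[of i] colI[of j] by auto
      qed (use EI[of i] EI[of j] ij in \<open>auto simp: insert_commute\<close>)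
    qed
    moreover have "card I = card D + card (I - D)"
    proof -
      have "D \<subseteq> I" by (auto simp: D_def)
      with finI show ?thesis
        using card_mono[of I D] card_Diff_subset[of D I] finite_subset[of D I] by simp
    qed
    ultimately show "card {b. (a, b) \<in> R \<and> (a', b) \<in> R} \<le> 5"
      unfolding I_def[symmetric] by linarith
  qed
  ultimately show ?thesis by simp
qed

text \<open>
  Of the three pairs in a triple, two are both heavy or both light; they share a vertex, which is put last.
  The constant is \<open>27 * (259 + 7)\<close>, where \<open>259 = 7 * (35 + 2)\<close>.
\<close>

lemma card_triples_le:
  assumes V: "finite V" "card V \<le> n" and EV: "\<Union>E \<subseteq> V"
  shows "real (card E) \<le> 7182 * (real n * sqrt (real n))"
proof -
  (* h tells whether the two pairs at the last vertex are heavy. *)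
  define T where "T h = {(a, b, c). {a, b, c} \<in> E \<and> heavy E a c = h \<and> heavy E b c = h}" for h
  have T_sub: "T h \<subseteq> V \<times> V \<times> V" for h using EV by (auto simp: T_def)
  have finT: "finite (T h)" for h using V T_sub by (meson finite_SigmaI finite_subset)
  have T_dist: "distinct [a, b, c]" if "(a, b, c) \<in> T h" for a b c h
    using that triple_distinct by (auto simp: T_def)
  have "E \<subseteq> (\<lambda>(a, b, c). {a, b, c}) ` (T False \<union> T True)"
  proof
    fix e assume e: "e \<in> E"
    then obtain x y z where xyz: "e = {x, y, z}"
      using card_triple by (metis card_3_iff)
    have "\<exists>h. (x, y, z) \<in> T h \<or> (x, z, y) \<in> T h \<or> (y, z, x) \<in> T h"
      using e heavy_commute[of E x y] heavy_commute[of E x z] heavy_commute[of E y z]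
      unfolding xyz T_def by (auto simp: insert_commute)
    then obtain h a b c where "(a, b, c) \<in> T h" "e = {a, b, c}"
      unfolding xyz by (metis insert_commute)
    then have "e \<in> (\<lambda>(a, b, c). {a, b, c}) ` T h" by force
    then show "e \<in> (\<lambda>(a, b, c). {a, b, c}) ` (T False \<union> T True)"
      by (cases h) auto
  qed
  then have "card E \<le> card (T False \<union> T True)"
    using finT by (intro surj_card_le) auto
  then have "card E \<le> card (T False) + card (T True)"
    using card_Un_le[of "T False" "T True"] by linarith
  moreover have "real (card (T False)) \<le> 27 * (259 * (real n * sqrt (real n)))"
  proof -
    obtain f :: "'a \<Rightarrow> nat"
      where f: "card (T False) \<le> 27 * card {(a, b, c) \<in> T False. f a = 0 \<and> f b = 1 \<and> f c = 2}"
      by (rule exists_tripartite_colouring[OF V(1) T_sub T_dist])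
    have "real (card {(a, b, c) \<in> T False. f a = 0 \<and> f b = 1 \<and> f c = 2}) \<le> 259 * (real n * sqrt (real n))"
      by (rule card_light_triples_le[OF V, where f = f]) (use T_sub in \<open>auto simp: T_def\<close>)
    with f show ?thesis by linarith
  qed
  moreover have "real (card (T True)) \<le> 27 * (7 * (real n * sqrt (real n)))"
  proof -
    obtain f :: "'a \<Rightarrow> nat"
      where f: "card (T True) \<le> 27 * card {(a, b, c) \<in> T True. f a = 0 \<and> f b = 1 \<and> f c = 2}"
      by (rule exists_tripartite_colouring[OF V(1) T_sub T_dist])
    have "real (card {(a, b, c) \<in> T True. f a = 0 \<and> f b = 1 \<and> f c = 2}) \<le> 7 * (real n * sqrt (real n))"
      by (rule card_heavy_triples_le[OF V, where f = f]) (use T_sub in \<open>auto simp: T_def\<close>)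
    with f show ?thesis by linarith
  qed
  ultimately show ?thesis by linarith
qed

end

text \<open>
  A forbidden system is embedded by listing the images of its vertices in the order \<open>0, 1, 2, ...\<close>.
\<close>

lemma F_free_triples_if_family_free:
  assumes H: "triple_system H" and free: "family_free {F1, F2, F3} H"
  shows "F_free_triples (triples H)"
proof unfold_locales
  have fin: "finite (verts H)" and triple: "\<And>e. e \<in> triples H \<Longrightarrow> e \<subseteq> verts H \<and> card e = 3"
    using H by (auto simp: triple_system_def)
  then have "triples H \<subseteq> Pow (verts H)" by blast
  with fin show "finite (triples H)" by (meson finite_Pow_iff finite_subset)
  show "card e = 3" if "e \<in> triples H" for e using triple[OF that] by simp
  (* The last hypothesis says that every chosen vertex lies in a chosen triple, hence in the host. *)
  have no_copy: False
    if F: "F \<in> {F1, F2, F3}" and xs: "distinct xs" "verts F = {..<length xs}"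
      and tri: "\<And>e. e \<in> triples F \<Longrightarrow> (!) xs ` e \<in> triples H"
      and cover: "set xs \<subseteq> \<Union>((`) ((!) xs) ` triples F)" for F xs
  proof -
    have "set xs \<subseteq> verts H" using cover tri triple by blast
    then have "contains_copy H F"
      unfolding contains_copy_def using xs tri
      by (intro exI[of _ "(!) xs"]) (auto intro!: inj_on_nth)
    with free F show False by (auto simp: family_free_def)
  qed
  show False if d: "distinct [v0, v1, v2, v3, w0, w1, w2, w3]" and "{w0, v0, v1} \<in> triples H"
    "{w1, v1, v2} \<in> triples H" "{w2, v2, v3} \<in> triples H" "{w3, v3, v0} \<in> triples H"
    for v0 v1 v2 v3 w0 w1 w2 w3
    by (rule no_copy[OF _ d, of F1]) (use that(2-) in \<open>auto simp: F1_eq\<close>)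
  show False if d: "distinct [v0, v1, v2, v3, w]" and "{w, v0, v1} \<in> triples H"
    "{w, v1, v2} \<in> triples H" "{w, v2, v3} \<in> triples H" "{w, v3, v0} \<in> triples H"
    for v0 v1 v2 v3 w
    by (rule no_copy[OF _ d, of F2]) (use that(2-) in \<open>auto simp: F2_eq\<close>)
  show False if d: "distinct [v0, v1, v2, v3, w, w']" and "{w, v0, v1} \<in> triples H"
    "{w, v1, v2} \<in> triples H" "{w', v2, v3} \<in> triples H" "{w', v3, v0} \<in> triples H"
    for v0 v1 v2 v3 w w'
    by (rule no_copy[OF _ d, of F3]) (use that(2-) in \<open>auto simp: F3_eq\<close>)
qed

lemma ex_triples_upper_bound: "real (ex_triples n {F1, F2, F3}) \<le> 7182 * (real n * sqrt (real n))"
proof -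
  let ?S = "{card (triples H) | H :: nat tsys. triple_system H \<and> card (verts H) = n \<and> family_free {F1, F2, F3} H}"
  have "?S \<noteq> {}"
    by (rule ex_triples_set_nonempty) (auto simp: F1_eq F2_eq F3_eq)
  then have "ex_triples n {F1, F2, F3} \<in> ?S"
    unfolding ex_triples_def by (rule Max_in[OF finite_ex_triples_set])
  then obtain H :: "nat tsys" where eq: "ex_triples n {F1, F2, F3} = card (triples H)"
    and H: "triple_system H" "card (verts H) = n" "family_free {F1, F2, F3} H" by blast
  interpret F_free_triples "triples H"
    by (rule F_free_triples_if_family_free[OF H(1,3)])
  show ?thesis
    unfolding eq using H by (intro card_triples_le[of "verts H"]) (auto simp: triple_system_def)
qed

section \<open>Fields of characteristic two\<close>

text \<open>
  Over an algebraically closed field the polynomial is a product of linear factors, and a repeated factor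
  would give a common root with the derivative.
\<close>

lemma card_roots_eq_degree:
  fixes p :: "'a :: alg_closed_field poly"
  assumes p: "p \<noteq> 0" and simple: "\<And>x. poly p x = 0 \<Longrightarrow> poly (pderiv p) x \<noteq> 0"
  shows "card {x. poly p x = 0} = degree p"
proof -
  obtain A where A: "size A = degree p" "p = smult (lead_coeff p) (\<Prod>x\<in>#A. [:-x, 1:])"
    using alg_closed_imp_factorization[OF p] by blast
  have "count A x \<le> 1" for x
  proof (rule ccontr)
    assume "\<not> count A x \<le> 1"
    then have "{#x, x#} \<subseteq># A" by (auto simp: subseteq_mset_def)
    then obtain B where "A = {#x, x#} + B" by (metis subset_mset.add_diff_inverse)
    with A(2) have "p = [:-x, 1:] * ([:-x, 1:] * smult (lead_coeff p) (\<Prod>x\<in>#B. [:-x, 1:]))"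
      by simp
    then obtain q where q: "p = [:-x, 1:] * ([:-x, 1:] * q)" by blast
    have "poly p x = 0" "poly (pderiv p) x = 0"
      unfolding q by (simp_all only: poly_mult pderiv_mult poly_add) simp_all
    with simple show False by blast
  qed
  then have "size A = card (set_mset A)"
    by (metis count_greater_zero_iff le_antisym less_one not_le size_multiset_overloaded_eq sum.cong card_eq_sum One_nat_def Suc_leI)
  moreover have "poly p x = 0 \<longleftrightarrow> x \<in># A" for x
  proof -
    have "poly p x = lead_coeff p * (\<Prod>y\<in>#A. x - y)"
      by (subst A(2)) (simp add: poly_prod_mset image_mset.compositionality o_def)
    then show ?thesis using p by (auto simp: prod_mset_zero_iff)
  qed
  ultimately show ?thesis using A(1) by simp
qed

text \<open>
  For positive \<open>k\<close> this is the field with \<open>2 ^ k\<close> elements, obtained as the fixed points of the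
  \<open>k\<close>-th power of the Frobenius map in the algebraic closure of the two-element field. The powers of
  \<open>2\<close> supply planes whose consecutive orders have a bounded ratio, as a bound for all \<open>n\<close> requires.
\<close>

definition binary_field :: "nat \<Rightarrow> bit alg_closure set" where
  "binary_field k = {x. x ^ 2 ^ k = x}"

lemma two_eq_0_bit_closure: "(2 :: bit alg_closure) = 0"
proof -
  have "(2 :: bit alg_closure) = to_ac (2 :: bit)" by (rule to_ac_numeral[symmetric])
  also have "(2 :: bit) = 0" by simp
  finally show ?thesis by simp
qed

lemma frobenius_add: "(x + y :: bit alg_closure) ^ 2 ^ k = x ^ 2 ^ k + y ^ 2 ^ k"
proof (induction k)
  case (Suc k)
  then show ?case
    by (simp add: power_mult power2_sum two_eq_0_bit_closure mult.commute[of 2])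
qed simp

lemma binary_field_add: "x \<in> binary_field k \<Longrightarrow> y \<in> binary_field k \<Longrightarrow> x + y \<in> binary_field k"
  by (simp add: binary_field_def frobenius_add)

lemma binary_field_mult: "x \<in> binary_field k \<Longrightarrow> y \<in> binary_field k \<Longrightarrow> x * y \<in> binary_field k"
  by (simp add: binary_field_def power_mult_distrib)

text \<open>
  The elements are the roots of \<open>X ^ 2 ^ k - X\<close>, whose derivative is the constant \<open>-1\<close> in
  characteristic \<open>2\<close>.
\<close>

lemma card_binary_field:
  assumes "0 < k"
  shows "card (binary_field k) = 2 ^ k"
proof -
  define p :: "bit alg_closure poly" where "p = monom 1 (2 ^ k) - monom 1 1"
  have k: "1 < (2::nat) ^ k" using assms by (rule one_less_power[rotated]) simp
  have "degree p = 2 ^ k"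
    unfolding p_def using k by (subst diff_conv_add_uminus, subst degree_add_eq_left) (auto simp: degree_monom_eq)
  moreover from this k have "p \<noteq> 0" by auto
  moreover have "poly (pderiv p) x = - 1" for x
  proof -
    have "(of_nat (2 ^ k) :: bit alg_closure) = 0"
      using assms two_eq_0_bit_closure by (cases k) auto
    then show ?thesis by (simp add: p_def pderiv_diff pderiv_monom poly_monom)
  qed
  moreover have "binary_field k = {x. poly p x = 0}"
    by (auto simp: binary_field_def p_def poly_monom)
  ultimately show ?thesis using card_roots_eq_degree[of p] by simp
qed

section \<open>The lower bound\<close>

definition has_special_four_cycle :: "'a set set \<Rightarrow> bool" where
  "has_special_four_cycle E \<longleftrightarrow> (\<exists>v w. special_four_cycle v w \<and> triples (four_cycle_system v w) \<subseteq> E)"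

lemma contains_copy_four_cycle_system:
  assumes "special_four_cycle v w" and "contains_copy H (four_cycle_system v w)"
  shows "has_special_four_cycle (triples H)"
proof -
  obtain f where inj: "inj_on f (v ` {..<4} \<union> w ` {..<4})"
    and f: "\<And>i. i < 4 \<Longrightarrow> f ` {w i, v i, v ((i + 1) mod 4)} \<in> triples H"
    using assms(2) unfolding contains_copy_def four_cycle_system_def by auto
  have "special_four_cycle (f \<circ> v) (f \<circ> w)"
    unfolding special_four_cycle_def
  proof safe
    show "inj_on (f \<circ> v) {..<4}"
      using assms(1) by (intro comp_inj_on inj_on_subset[OF inj]) (auto simp: special_four_cycle_def)
    fix i j :: nat assume "i < 4" "j < 4" "(f \<circ> w) i = (f \<circ> v) j"
    then show False
      using inj_onD[OF inj, of "w i" "v j"] assms(1) by (auto simp: special_four_cycle_def)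
  qed
  moreover have "triples (four_cycle_system (f \<circ> v) (f \<circ> w)) \<subseteq> triples H"
    using f by (auto simp: four_cycle_system_def)
  ultimately show ?thesis unfolding has_special_four_cycle_def by blast
qed

lemma family_free_if_no_special_four_cycle:
  assumes "\<not> has_special_four_cycle (triples H)"
  shows "family_free {F1, F2, F3} H"
  using assms unfolding family_free_def F1_def F2_def F3_def
  by (auto dest: contains_copy_four_cycle_system[OF special_four_cycle_F(1)]
    contains_copy_four_cycle_system[OF special_four_cycle_F(2)]
    contains_copy_four_cycle_system[OF special_four_cycle_F(3)])

lemma has_special_four_cycle_image:
  assumes inj: "inj_on h (\<Union>E)" and "has_special_four_cycle ((`) h ` E)"
  shows "has_special_four_cycle E"
proof -
  obtain v w where vw: "special_four_cycle v w"
    and "triples (four_cycle_system v w) \<subseteq> (`) h ` E"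
    using assms(2) unfolding has_special_four_cycle_def by blast
  then have sub: "{w i, v i, v ((i + 1) mod 4)} \<in> (`) h ` E" if "i < 4" for i
    using that by (auto simp: four_cycle_system_def)
  define g where "g = inv_into (\<Union>E) h"
  have mem: "w i \<in> h ` \<Union>E" "v i \<in> h ` \<Union>E" if i: "i < 4" for i
  proof -
    obtain e where e: "e \<in> E" "{w i, v i, v ((i + 1) mod 4)} = h ` e" using sub[OF i] by auto
    have "{w i, v i} \<subseteq> h ` e" unfolding e(2)[symmetric] by auto
    with e(1) show "w i \<in> h ` \<Union>E" "v i \<in> h ` \<Union>E" by auto
  qed
  have inj_g: "inj_on g (h ` \<Union>E)" unfolding g_def by (rule inj_on_inv_into) simp
  have "special_four_cycle (g \<circ> v) (g \<circ> w)"
    unfolding special_four_cycle_def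
  proof safe
    show "inj_on (g \<circ> v) {..<4}"
      using vw mem by (intro comp_inj_on inj_on_subset[OF inj_g]) (auto simp: special_four_cycle_def)
    fix i j :: nat assume "i < 4" "j < 4" "(g \<circ> w) i = (g \<circ> v) j"
    then show False
      using inj_onD[OF inj_g, of "w i" "v j"] vw mem by (auto simp: special_four_cycle_def)
  qed
  moreover have "triples (four_cycle_system (g \<circ> v) (g \<circ> w)) \<subseteq> E"
  proof -
    have "{g (w i), g (v i), g (v ((i + 1) mod 4))} \<in> E" if i: "i < 4" for i
    proof -
      obtain e where e: "e \<in> E" "{w i, v i, v ((i + 1) mod 4)} = h ` e" using sub[OF i] by auto
      have "{g (w i), g (v i), g (v ((i + 1) mod 4))} = g ` h ` e" unfolding e(2)[symmetric] by simp
      also have "\<dots> = e" unfolding g_def using e(1) inj by (intro inv_into_image_cancel) auto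
      finally show ?thesis using e(1) by simp
    qed
    then show ?thesis
      unfolding four_cycle_system_def by auto
  qed
  ultimately show ?thesis unfolding has_special_four_cycle_def by blast
qed

text \<open>
  Lower bounds may be witnessed over any vertex type and with fewer than \<open>n\<close> vertices: the system is
  relabelled by natural numbers and isolated vertices are added.
\<close>

lemma ex_triples_ge:
  fixes V :: "'a set" and E :: "'a set set"
  assumes H: "triple_system (V, E)" and n: "card V \<le> n" and free: "\<not> has_special_four_cycle E"
  shows "card E \<le> ex_triples n {F1, F2, F3}"
proof -
  have V: "finite V" and E: "\<And>e. e \<in> E \<Longrightarrow> e \<subseteq> V \<and> card e = 3"
    using H by (auto simp: triple_system_def)
  obtain h where h: "bij_betw h V {..<card V}"
    using V finite_same_card_bij[of V "{..<card V}"] by auto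
  have inj: "inj_on h V" using h by (rule bij_betw_imp_inj_on)
  let ?H = "({..<n}, (`) h ` E)"
  have sys: "triple_system ?H"
    unfolding triple_system_def
  proof (simp, safe)
    fix e x assume e: "e \<in> E"
    show "x \<in> e \<Longrightarrow> h x < n" using E[OF e] n bij_betw_apply[OF h, of x] by auto
    show "card (h ` e) = 3" using E[OF e] inj by (metis card_image inj_on_subset)
  qed
  have "\<not> has_special_four_cycle ((`) h ` E)"
    using free has_special_four_cycle_image[of h E] inj E by (meson Sup_least inj_on_subset)
  then have "family_free {F1, F2, F3} ?H"
    by (intro family_free_if_no_special_four_cycle) simp
  with sys have "card (triples ?H) \<in> {card (triples H) | H :: nat tsys.
      triple_system H \<and> card (verts H) = n \<and> family_free {F1, F2, F3} H}"
    by (intro CollectI exI[of _ ?H]) simp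
  then have "card (triples ?H) \<le> ex_triples n {F1, F2, F3}"
    unfolding ex_triples_def by (rule Max_ge[OF finite_ex_triples_set])
  moreover have "inj_on ((`) h) E"
    using E by (intro inj_onI) (meson inj inj_on_image_eq_iff)
  ultimately show ?thesis by (simp add: card_image)
qed

text \<open>
  A relation between points and lines is read as a bipartite graph; equivalently, two distinct points lie on
  at most one common line.
\<close>

definition C4_free :: "('p \<times> 'l) set \<Rightarrow> bool" where
  "C4_free R \<longleftrightarrow> (\<forall>p q l m. (p, l) \<in> R \<longrightarrow> (p, m) \<in> R \<longrightarrow> (q, l) \<in> R \<longrightarrow> (q, m) \<in> R \<longrightarrow> p = q \<or> l = m)"

text \<open>
  Every line is replaced by two copies, tagged by a Boolean, and each incidence becomes the triple of the
  point and both copies of the line.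
\<close>

definition doubled :: "('p \<times> 'l) set \<Rightarrow> ('p + 'l \<times> bool) set set" where
  "doubled R = (\<lambda>(p, l). {Inl p, Inr (l, False), Inr (l, True)}) ` R"

text \<open>
  Two vertices of a triple are a point and a copy of a line through it, in which case the third vertex is the
  other copy, or they are the two copies of one line.
\<close>

lemma doubled_adjacent:
  assumes e: "{z, u, u'} \<in> doubled R" and d: "distinct [z, u, u']"
  obtains (point_line) p l s where "(p, l) \<in> R" "u = Inl p" "u' = Inr (l, s)" "z = Inr (l, \<not> s)"
    | (line_point) p l s where "(p, l) \<in> R" "u = Inr (l, s)" "u' = Inl p" "z = Inr (l, \<not> s)"
    | (line_line) l s where "u = Inr (l, s)" "u' = Inr (l, \<not> s)"
proof -
  obtain p l where pl: "(p, l) \<in> R" and eq: "{z, u, u'} = {Inl p, Inr (l, False), Inr (l, True)}"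
    using e by (auto simp: doubled_def)
  have mem: "x = Inl p \<or> x = Inr (l, False) \<or> x = Inr (l, True)" if "x \<in> {z, u, u'}" for x
    using that unfolding eq by simp
  consider "u = Inl p" | "u' = Inl p" | "u \<noteq> Inl p" "u' \<noteq> Inl p" by blast
  then show thesis
  proof cases
    case 1
    with mem[of u'] mem[of z] d pl show thesis
      by (intro point_line[of p l "u' = Inr (l, True)"]) auto
  next
    case 2
    with mem[of u] mem[of z] d pl show thesis
      by (intro line_point[of p l "u = Inr (l, True)"]) auto
  next
    case 3
    with mem[of u] mem[of u'] d show thesis
      by (intro line_line[of l "u = Inr (l, True)"]) auto
  qed
qed

text \<open>
  If three consecutive base vertices were copies of lines, they would all be copies of the same line, but a
  line has only two copies.
\<close>

lemma doubled_no_three_copies: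
  assumes "{z, u, u'} \<in> doubled R" "{z', u', u''} \<in> doubled R"
    and "distinct [z, u, u']" "distinct [z', u', u'']" "u \<noteq> u''"
  shows "isl u \<or> isl u' \<or> isl u''"
proof (cases rule: doubled_adjacent[OF assms(1,3)])
  case (3 l s)
  note uu' = 3
  show ?thesis
  proof (cases rule: doubled_adjacent[OF assms(2,4)])
    case (3 m t)
    with uu' assms(5) show ?thesis by auto
  qed simp_all
qed simp_all

lemma doubled_point_neighbour:
  assumes e: "{z, Inl p, u} \<in> doubled R" and d: "distinct [z, Inl p, u]"
  obtains l s where "(p, l) \<in> R" "u = Inr (l, s)" "z = Inr (l, \<not> s)"
proof (cases rule: doubled_adjacent[OF e d])
  case (1 q l s)
  then show ?thesis using that by auto
qed simp_all

text \<open>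
  If two opposite base vertices are points \<open>p \<noteq> q\<close>, the other two are copies of lines through both of
  them, hence the two copies of one line. Then the triple on \<open>v0 v1\<close> also contains the base vertex
  \<open>v3\<close>.
\<close>

lemma doubled_no_two_points:
  assumes C4: "C4_free R"
    and e: "{z0, v0, v1} \<in> doubled R" "{z1, v1, v2} \<in> doubled R" "{z2, v2, v3} \<in> doubled R" "{z3, v3, v0} \<in> doubled R"
    and points: "isl v0" "isl v2"
    and d: "distinct [v0, v1, v2, v3]" "{z0, z1, z2, z3} \<inter> {v0, v1, v2, v3} = {}"
  shows False
proof -
  obtain p q where pq: "v0 = Inl p" "v2 = Inl q" using points by (auto simp: isl_def)
  have edges: "{z0, Inl p, v1} \<in> doubled R" "{z1, Inl q, v1} \<in> doubled R" "{z2, Inl q, v3} \<in> doubled R"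
    "{z3, Inl p, v3} \<in> doubled R"
    using e unfolding pq by (simp_all add: insert_commute)
  have dist: "distinct [z0, Inl p, v1]" "distinct [z1, Inl q, v1]" "distinct [z2, Inl q, v3]"
    "distinct [z3, Inl p, v3]"
    using d unfolding pq by auto
  obtain l s where l: "(p, l) \<in> R" "v1 = Inr (l, s)" "z0 = Inr (l, \<not> s)"
    by (rule doubled_point_neighbour[OF edges(1) dist(1)])
  obtain l' s' where l': "(q, l') \<in> R" "v1 = Inr (l', s')"
    by (rule doubled_point_neighbour[OF edges(2) dist(2)])
  obtain m t where m: "(q, m) \<in> R" "v3 = Inr (m, t)"
    by (rule doubled_point_neighbour[OF edges(3) dist(3)])
  obtain m' t' where m': "(p, m') \<in> R" "v3 = Inr (m', t')"
    by (rule doubled_point_neighbour[OF edges(4) dist(4)])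
  have "(q, l) \<in> R" "(p, m) \<in> R" using l l' m m' by auto
  then have "l = m" using C4 l m pq d unfolding C4_free_def by auto
  then show False using l m d by auto
qed

text \<open>
  Adjacent base vertices are not both points, so either two opposite base vertices are points or three
  consecutive ones are copies of lines; both have been excluded.
\<close>

lemma no_special_four_cycle_doubled:
  assumes C4: "C4_free R"
  shows "\<not> has_special_four_cycle (doubled R)"
proof
  assume "has_special_four_cycle (doubled R)"
  then obtain v w where vw: "special_four_cycle v w"
    and "triples (four_cycle_system v w) \<subseteq> doubled R"
    unfolding has_special_four_cycle_def by blast
  then have e: "{w i, v i, v ((i + 1) mod 4)} \<in> doubled R" if "i < 4" for i
    using that by (auto simp: four_cycle_system_def)
  have succ: "(0 + 1) mod 4 = (1::nat)" "(1 + 1) mod 4 = (2::nat)" "(2 + 1) mod 4 = (3::nat)" "(3 + 1) mod 4 = (0::nat)"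
    by simp_all
  have e': "{w 0, v 0, v 1} \<in> doubled R" "{w 1, v 1, v 2} \<in> doubled R" "{w 2, v 2, v 3} \<in> doubled R"
    "{w 3, v 3, v 0} \<in> doubled R"
    using e[of 0, unfolded succ] e[of 1, unfolded succ] e[of 2, unfolded succ] e[of 3, unfolded succ]
    by simp_all
  have d: "distinct [v 0, v 1, v 2, v 3]"
    using vw by (auto simp: special_four_cycle_def lessThan_4)
  have wv: "w i \<noteq> v j" if "i < 4" "j < 4" for i j using vw that by (auto simp: special_four_cycle_def)
  have d': "distinct [w 0, v 0, v 1]" "distinct [w 1, v 1, v 2]" "distinct [w 2, v 2, v 3]" "distinct [w 3, v 3, v 0]"
    using d wv by auto
  have no_points: "\<not> (isl u \<and> isl u')" if "{z, u, u'} \<in> doubled R" "distinct [z, u, u']" for z u u'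
    using that by (cases rule: doubled_adjacent) auto
  have "\<not> (isl (v 0) \<and> isl (v 2))"
  proof
    assume "isl (v 0) \<and> isl (v 2)"
    then have "isl (v 0)" "isl (v 2)" by simp_all
    with C4 e' show False
      by (rule doubled_no_two_points) (use d wv in auto)
  qed
  moreover have "\<not> (isl (v 1) \<and> isl (v 3))"
  proof
    assume "isl (v 1) \<and> isl (v 3)"
    then have "isl (v 1)" "isl (v 3)" by simp_all
    with C4 e'(2,3,4,1) show False
      by (rule doubled_no_two_points) (use d wv in auto)
  qed
  moreover have "isl (v 0) \<or> isl (v 1) \<or> isl (v 2)" "isl (v 1) \<or> isl (v 2) \<or> isl (v 3)"
      "isl (v 2) \<or> isl (v 3) \<or> isl (v 0)" "isl (v 3) \<or> isl (v 0) \<or> isl (v 1)"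
    using d doubled_no_three_copies[OF e'(1,2) d'(1,2)] doubled_no_three_copies[OF e'(2,3) d'(2,3)]
      doubled_no_three_copies[OF e'(3,4) d'(3,4)] doubled_no_three_copies[OF e'(4,1) d'(4,1)] by auto
  ultimately show False
    using no_points[OF e'(1) d'(1)] no_points[OF e'(2) d'(2)] no_points[OF e'(3) d'(3)] no_points[OF e'(4) d'(4)]
    by blast
qed

lemma card_doubled: "card (doubled R) = card R"
  unfolding doubled_def by (rule card_image) (auto simp: inj_on_def doubleton_eq_iff insert_eq_iff)

text \<open>
  The doubled affine plane over the field with \<open>q = 2 ^ k\<close> elements, restricted to the lines
  \<open>y = a x + b\<close>, has \<open>q\<^sup>2\<close> points, \<open>2 q\<^sup>2\<close> copies of lines and \<open>q\<^sup>3\<close> triples. Two lines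
  meeting in two points satisfy \<open>(a - a') (x - x') = 0\<close>.
\<close>

lemma ex_triples_ge_8_power:
  assumes k: "0 < k" and n: "3 * 4 ^ k \<le> n"
  shows "8 ^ k \<le> ex_triples n {F1, F2, F3}"
proof -
  let ?K = "binary_field k"
  have cardK: "card ?K = 2 ^ k" using card_binary_field[OF k] .
  then have finK: "finite ?K" by (intro card_ge_0_finite) simp
  define R where "R = (\<lambda>(a, b, x). ((x, a * x + b), (a, b))) ` (?K \<times> ?K \<times> ?K)"
  define V :: "((bit alg_closure \<times> bit alg_closure) + (bit alg_closure \<times> bit alg_closure) \<times> bool) set"
    where "V = (?K \<times> ?K) <+> ((?K \<times> ?K) \<times> UNIV)"
  have "card R = card (?K \<times> ?K \<times> ?K)"
    unfolding R_def by (rule card_image) (auto simp: inj_on_def)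
  then have "card R = 8 ^ k"
    by (simp add: card_cartesian_product cardK power_mult_distrib[symmetric])
  moreover have "card V = 3 * 4 ^ k"
    unfolding V_def using finK
    by (subst card_Plus) (auto simp: card_cartesian_product cardK power_mult_distrib[symmetric])
  moreover have "triple_system (V, doubled R)"
    using finK binary_field_add binary_field_mult
    by (auto simp: triple_system_def V_def R_def doubled_def)
  moreover have "\<not> has_special_four_cycle (doubled R)"
  proof (rule no_special_four_cycle_doubled, unfold C4_free_def, intro allI impI)
    fix p q l m assume "(p, l) \<in> R" "(p, m) \<in> R" "(q, l) \<in> R" "(q, m) \<in> R"
    then obtain x y x' y' a b a' b'
      where pl: "p = (x, y)" "q = (x', y')" "l = (a, b)" "m = (a', b')"
        and eqs: "y = a * x + b" "y = a' * x + b'" "y' = a * x' + b" "y' = a' * x' + b'"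
      by (auto simp: R_def)
    have "(a - a') * (x - x') = ((a * x + b) - (a' * x + b')) - ((a * x' + b) - (a' * x' + b'))"
      by (simp add: algebra_simps)
    also have "\<dots> = (y - y) - (y' - y')" using eqs by metis
    finally have "(a - a') * (x - x') = 0" by simp
    then show "p = q \<or> l = m" using eqs pl by auto
  qed
  ultimately show ?thesis
    using ex_triples_ge[of V "doubled R" n] n by (simp add: card_doubled)
qed

text \<open>
  With \<open>k\<close> maximal such that \<open>3 * 4 ^ k \<le> n\<close>, the bound \<open>n < 12 * 4 ^ k\<close> gives
  \<open>n powr (3/2) \<le> (12 * 4 ^ k) * (4 * 2 ^ k) = 48 * 8 ^ k\<close>. The hypothesis on \<open>n\<close> makes \<open>k\<close>
  positive.
\<close>

lemma ex_triples_lower_bound: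
  assumes n: "12 \<le> n"
  shows "real n * sqrt (real n) \<le> 48 * real (ex_triples n {F1, F2, F3})"
proof -
  have "1 \<le> n div 3" using n by linarith
  then obtain k where k: "4 ^ k \<le> n div 3" "n div 3 < 4 ^ (k + 1)"
    using ex_power_ivl1[of 4 "n div 3"] by auto
  have "0 < k" using k(2) n by (cases k) auto
  moreover have "3 * 4 ^ k \<le> n" using k(1) by linarith
  ultimately have low: "8 ^ k \<le> ex_triples n {F1, F2, F3}" by (rule ex_triples_ge_8_power)
  have "n < 3 * 4 ^ (k + 1)" using k(2) by linarith
  then have "real n \<le> real (12 * 4 ^ k)" by (simp only: of_nat_le_iff) simp
  then have n12: "real n \<le> 12 * 4 ^ k" by simp
  have "sqrt (real n) \<le> sqrt (16 * 4 ^ k)"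
    using n12 by (intro real_sqrt_le_mono order_trans[OF n12]) simp
  also have "\<dots> = 4 * 2 ^ k"
    by (intro real_sqrt_unique) (auto simp: power_mult_distrib power_mult[symmetric] mult.commute[of k] power_mult)
  finally have "real n * sqrt (real n) \<le> (12 * 4 ^ k) * (4 * 2 ^ k)"
    using n12 by (intro mult_mono) auto
  also have "\<dots> = 48 * 8 ^ k" by (simp add: power_mult_distrib[symmetric])
  also have "\<dots> \<le> 48 * real (ex_triples n {F1, F2, F3})"
    using low by (metis mult_left_mono of_nat_le_iff of_nat_numeral of_nat_power zero_le_numeral)
  finally show ?thesis .
qed

section \<open>The order of magnitude\<close>

theorem theorem1:
  "(\<lambda>n. real (ex_triples n {F1, F2, F3})) \<in> \<Theta>(\<lambda>n. real n powr (3 / 2))"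
proof (rule bigthetaI')
  have powr: "real n powr (3 / 2) = real n * sqrt (real n)" for n
    using powr_add[of "real n" 1 "1 / 2"] by (simp add: powr_half_sqrt)
  have "1 / 48 * (real n powr (3 / 2)) \<le> real (ex_triples n {F1, F2, F3})
      \<and> real (ex_triples n {F1, F2, F3}) \<le> 7182 * (real n powr (3 / 2))" if "12 \<le> n" for n
    using ex_triples_lower_bound[OF that] ex_triples_upper_bound[of n] by (simp add: powr)
  then show "\<forall>\<^sub>F n in sequentially.
      norm (real (ex_triples n {F1, F2, F3})) \<ge> 1 / 48 * norm (real n powr (3 / 2))
      \<and> norm (real (ex_triples n {F1, F2, F3})) \<le> 7182 * norm (real n powr (3 / 2))"
    by (auto intro!: eventually_sequentiallyI[of 12])
qed simp_all

end
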